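(* Let $U:\mathbb R^d\to\mathbb R$ be smooth and $\rho>0$. Take $\alpha=1/2$ and the Runge-Kutta convolution quadrature associated with the 2-stage Lobatto IIIC method. Consider the corresponding fractional variational integrator with step $h>0$, i.e. the one-step map $(x_k,p_k)\mapsto(x_{k+1},p_{k+1})$ defined implicitly by $$p_k=\frac1h(x_{k+1}-x_k)+\frac h2\nabla U(x_k)+\frac\rho2(x_{k+1}-x_k),$$ $$p_{k+1}=\frac1h(x_{k+1}-x_k)-\frac h2\nabla U(x_{k+1})-\frac\rho2(x_{k+1}-x_k),$$ applied to the system $$\dot x=p,\qquad \dot p=-\nabla U(x)-\rho\,D_-^{(2\alpha)}x,$$ where, since $2\alpha=1$, $D_-^{(2\alpha)}x=\dot x$. This integrator is a second-order accurate method for both the $x$ and $p$ variables, meaning that its local errors are $O(h^3)$: if $(x_{\mathrm{ex}},p_{\mathrm{ex}})$ is an exact solution of the system on $[0,T]$, $t_k\in[0,T)$, $t_{k+1}=t_k+h\le T$, and $(x_k,p_k)=(x_{\mathrm{ex}}(t_k),p_{\mathrm{ex}}(t_k))$, then as $h\to0$ $$\|x_{k+1}-x_{\mathrm{ex}}(t_{k+1})\|=O(h^3),\qquad \|p_{k+1}-p_{\mathrm{ex}}(t_{k+1})\|=O(h^3).$$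
   Context: The system is the restricted Hamiltonian form of $\ddot x+\nabla U(x)=-\rho D_-^{(2\alpha)}x$ for the mechanical Lagrangian $L(q,\dot q)=\frac12\dot q^\top\dot q-U(q)$, with $D_-^{\beta}$ the left Riemann-Liouville derivative (so $D_-^{1}x=\dot x$). Origin of the scheme: the discrete Lagrangian is $L_d(x_k,x_{k+1})=\frac h2L\big(x_k,\frac{x_{k+1}-x_k}{h}\big)+\frac h2L\big(x_{k+1},\frac{x_{k+1}-x_k}{h}\big)$. The 2-stage Lobatto IIIC method has $A=\begin{pmatrix}1/2&-1/2\\1/2&1/2\end{pmatrix}$, $\mathbf b=(1/2,1/2)^\top$, $\mathbf c=(0,1)^\top$. For $2\alpha=1$ the convolution quadrature of the (first) derivative of $\mathbf x_k=(x_k,x_{k+1})^\top$ is taken as $\mathcal D_-^{(2\alpha)}\mathbf x_k=\frac1h\,(x_{k+1}-x_k,\ x_{k+1}-x_k)^\top$. The two equations of the scheme are the discrete Legendre transforms $p_k=-D_1L_d(x_k,x_{k+1})+\frac{\rho h}{2}[\mathcal D_-^{(2\alpha)}\mathbf x_k]^1$ and $p_{k+1}=D_2L_d(x_k,x_{k+1})-\frac{\rho h}{2}[\mathcal D_-^{(2\alpha)}\mathbf x_k]^2$, where $[\cdot]^i$ is the $i$-th component. *)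

theory Defs
  imports "HOL-Analysis.Analysis"
begin

text \<open>All iterated directional derivatives of order below \<open>n\<close> exist and are (totally)
  differentiable, and those of order \<open>n\<close> are continuous; that is, \<open>f\<close> is of class \<open>C\<^sup>n\<close>.\<close>

fun C_order :: "nat \<Rightarrow> ('a::euclidean_space \<Rightarrow> real) \<Rightarrow> bool" where
  "C_order 0 f \<longleftrightarrow> continuous_on UNIV f"
| "C_order (Suc n) f \<longleftrightarrow>
     (\<forall>x. f differentiable (at x)) \<and> (\<forall>v. C_order n (\<lambda>x. frechet_derivative f (at x) v))"

definition smooth :: "('a::euclidean_space \<Rightarrow> real) \<Rightarrow> bool" where
  "smooth f \<longleftrightarrow> (\<forall>n. C_order n f)"

definition gradient :: "('a::euclidean_space \<Rightarrow> real) \<Rightarrow> 'a \<Rightarrow> 'a" where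
  "gradient f x = (THE g. GDERIV f x :> g)"

lemma gradient_eq:
  assumes "GDERIV f x :> g"
  shows "gradient f x = g"
  unfolding gradient_def
proof (rule the_equality[where P = "\<lambda>g. GDERIV f x :> g", OF assms])
  fix g' assume "GDERIV f x :> g'"
  then have "(\<lambda>h. h \<bullet> g') = (\<lambda>h. h \<bullet> g)"
    using assms unfolding gderiv_def by (rule has_derivative_unique)
  then show "g' = g"
    by (simp add: fun_eq_iff) (metis vector_eq_ldot)
qed

lemma GDERIV_gradient:
  assumes "f differentiable (at x)"
  shows "GDERIV f x :> gradient f x"
proof -
  define F where "F = frechet_derivative f (at x)"
  have F: "(f has_derivative F) (at x)"
    using assms unfolding F_def by (simp add: frechet_derivative_works)
  then interpret linear F by (rule has_derivative_linear)
  have "F h = h \<bullet> (\<Sum>i\<in>Basis. F i *\<^sub>R i)" for h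
  proof -
    have "F h = F (\<Sum>i\<in>Basis. (h \<bullet> i) *\<^sub>R i)"
      by (simp add: euclidean_representation)
    also have "\<dots> = h \<bullet> (\<Sum>i\<in>Basis. F i *\<^sub>R i)"
      by (simp add: sum scale inner_sum_right mult.commute)
    finally show ?thesis .
  qed
  then have "F = (\<lambda>h. h \<bullet> (\<Sum>i\<in>Basis. F i *\<^sub>R i))" ..
  then have "GDERIV f x :> (\<Sum>i\<in>Basis. F i *\<^sub>R i)"
    using F unfolding gderiv_def by simp
  then show ?thesis by (metis gradient_eq)
qed

lemma smooth_GDERIV: "smooth f \<Longrightarrow> GDERIV f x :> gradient f x"
  unfolding smooth_def by (metis C_order.simps(2) GDERIV_gradient)

text \<open>The left Riemann-Liouville integral and derivative on \<open>[a, b]\<close>. The derivative of order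
  \<open>\<beta> \<ge> 0\<close> is \<open>(d/dt)\<^sup>n\<close> applied to the integral of order \<open>n - \<beta>\<close>, with the standard choice
  \<open>n - 1 \<le> \<beta> < n\<close>, so that the kernel is integrable for every \<open>\<beta>\<close>. At \<open>a\<close> and \<open>b\<close> the
  derivatives are one-sided. The value of the kernel at \<open>s = t\<close>, where HOL has \<open>0 powr 0 = 0\<close>,
  does not affect the integral.\<close>

definition RL_integral :: "real \<Rightarrow> real \<Rightarrow> (real \<Rightarrow> 'a::euclidean_space) \<Rightarrow> real \<Rightarrow> 'a" where
  "RL_integral a \<mu> f t =
     (1 / Gamma \<mu>) *\<^sub>R integral {a..t} (\<lambda>s. ((t - s) powr (\<mu> - 1)) *\<^sub>R f s)"

definition RL_derivative ::
    "real \<Rightarrow> real \<Rightarrow> real \<Rightarrow> (real \<Rightarrow> 'a::euclidean_space) \<Rightarrow> real \<Rightarrow> 'a" where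
  "RL_derivative a b \<beta> f =
     (let n = nat \<lfloor>\<beta>\<rfloor> + 1
      in ((\<lambda>g t. vector_derivative g (at t within {a..b})) ^^ n) (RL_integral a (real n - \<beta>) f))"

lemma RL_derivative_1:
  assumes t: "t \<in> {a..b}" and "a < b"
    and f: "\<And>s. s \<in> {a..b} \<Longrightarrow> (f has_vector_derivative f' s) (at s within {a..b})"
  shows "RL_derivative a b 1 f t = f' t"
proof -
  have cont: "continuous_on {a..b} f"
    using f by (meson continuous_on_eq_continuous_within has_vector_derivative_continuous)
  have I: "RL_integral a 1 f = (\<lambda>u. integral {a..u} f)"
  proof
    fix u
    have "integral {a..u} (\<lambda>s. ((u - s) powr (1 - 1)) *\<^sub>R f s) = integral {a..u} f"
      by (rule integral_spike[of "{u}"]) auto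
    then show "RL_integral a 1 f u = integral {a..u} f"
      by (simp add: RL_integral_def)
  qed
  have 1: "vector_derivative (\<lambda>u. integral {a..u} f) (at s within {a..b}) = f s"
    if "s \<in> {a..b}" for s
    using vector_derivative_within_closed_interval[OF \<open>a < b\<close> that]
      integral_has_vector_derivative[OF cont that] by blast
  have "((\<lambda>s. vector_derivative (\<lambda>u. integral {a..u} f) (at s within {a..b}))
      has_vector_derivative f' t) (at t within {a..b})"
    using has_vector_derivative_transform[OF t 1 f[OF t]] by blast
  then have "vector_derivative (\<lambda>s. vector_derivative (\<lambda>u. integral {a..u} f)
      (at s within {a..b})) (at t within {a..b}) = f' t"
    using vector_derivative_within_closed_interval[OF \<open>a < b\<close> t] by blast
  then show ?thesis
    by (simp add: RL_derivative_def I numeral_2_eq_2)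
qed

definition frac_damped_solution ::
    "('a::euclidean_space \<Rightarrow> real) \<Rightarrow> real \<Rightarrow> real \<Rightarrow> real \<Rightarrow> (real \<Rightarrow> 'a) \<Rightarrow> (real \<Rightarrow> 'a) \<Rightarrow> bool" where
  "frac_damped_solution U \<rho> \<alpha> T x p \<longleftrightarrow>
     (\<forall>t\<in>{0..T}.
        (x has_vector_derivative p t) (at t within {0..T}) \<and>
        (p has_vector_derivative - gradient U (x t) - \<rho> *\<^sub>R RL_derivative 0 T (2 * \<alpha>) x t)
          (at t within {0..T}))"

lemma frac_damped_solution_half:
  assumes "T > 0"
  shows "frac_damped_solution U \<rho> (1/2) T x p \<longleftrightarrow>
     (\<forall>t\<in>{0..T}. (x has_vector_derivative p t) (at t within {0..T}) \<and>
        (p has_vector_derivative - gradient U (x t) - \<rho> *\<^sub>R p t) (at t within {0..T}))"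
proof (cases "\<forall>t\<in>{0..T}. (x has_vector_derivative p t) (at t within {0..T})")
  case True
  then have "RL_derivative 0 T 1 x t = p t" if "t \<in> {0..T}" for t
    using that assms by (intro RL_derivative_1) auto
  then show ?thesis by (simp add: frac_damped_solution_def)
qed (auto simp: frac_damped_solution_def)

text \<open>One step of the scheme from \<open>(x, p)\<close> to \<open>(x', p')\<close> with step \<open>h\<close>.\<close>

definition fvi_step ::
    "('a::euclidean_space \<Rightarrow> real) \<Rightarrow> real \<Rightarrow> real \<Rightarrow> 'a \<times> 'a \<Rightarrow> 'a \<times> 'a \<Rightarrow> bool" where
  "fvi_step U \<rho> h = (\<lambda>(x, p) (x', p').
     p  = (1 / h) *\<^sub>R (x' - x) + (h / 2) *\<^sub>R gradient U x  + (\<rho> / 2) *\<^sub>R (x' - x) \<and>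
     p' = (1 / h) *\<^sub>R (x' - x) - (h / 2) *\<^sub>R gradient U x' - (\<rho> / 2) *\<^sub>R (x' - x))"

definition fvi_map ::
    "('a::euclidean_space \<Rightarrow> real) \<Rightarrow> real \<Rightarrow> real \<Rightarrow> 'a \<times> 'a \<Rightarrow> 'a \<times> 'a" where
  "fvi_map U \<rho> h z = (THE z'. fvi_step U \<rho> h z z')"

lemma fvi_step_ex1:
  assumes "h > 0" "\<rho> > 0"
  shows "\<exists>!z'. fvi_step U \<rho> h z z'"
proof -
  obtain x p where z: "z = (x, p)" by fastforce
  define c where "c = 1 / h + \<rho> / 2"
  have c: "c \<noteq> 0" using assms by (smt (verit) c_def divide_pos_pos)
  have "p = (1 / h) *\<^sub>R (x' - x) + (h / 2) *\<^sub>R gradient U x + (\<rho> / 2) *\<^sub>R (x' - x) \<longleftrightarrow>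
      x' = x + (1 / c) *\<^sub>R (p - (h / 2) *\<^sub>R gradient U x)" for x'
  proof -
    have "p = (1 / h) *\<^sub>R (x' - x) + (h / 2) *\<^sub>R gradient U x + (\<rho> / 2) *\<^sub>R (x' - x) \<longleftrightarrow>
        c *\<^sub>R (x' - x) = p - (h / 2) *\<^sub>R gradient U x"
      unfolding c_def scaleR_left_distrib by (auto simp: eq_diff_eq add_ac)
    also have "\<dots> \<longleftrightarrow> x' - x = (1 / c) *\<^sub>R (p - (h / 2) *\<^sub>R gradient U x)"
    proof
      assume "c *\<^sub>R (x' - x) = p - (h / 2) *\<^sub>R gradient U x"
      then have "(1 / c) *\<^sub>R (c *\<^sub>R (x' - x)) = (1 / c) *\<^sub>R (p - (h / 2) *\<^sub>R gradient U x)"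
        by (rule arg_cong)
      then show "x' - x = (1 / c) *\<^sub>R (p - (h / 2) *\<^sub>R gradient U x)"
        using c by simp
    qed (use c in simp)
    also have "\<dots> \<longleftrightarrow> x' = x + (1 / c) *\<^sub>R (p - (h / 2) *\<^sub>R gradient U x)"
      by (auto simp: algebra_simps)
    finally show ?thesis .
  qed
  then show ?thesis
    unfolding z fvi_step_def by auto
qed

lemma fvi_step_fvi_map:
  "h > 0 \<Longrightarrow> \<rho> > 0 \<Longrightarrow> fvi_step U \<rho> h z (fvi_map U \<rho> h z)"
  unfolding fvi_map_def by (rule theI'[OF fvi_step_ex1])

text \<open>The scheme consists of the forced discrete Legendre transforms of the discrete
  Lagrangian \<open>Ld\<close>, where \<open>cq\<close> is the Lobatto IIIC convolution quadrature of the first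
  derivative.\<close>

definition mech_lagrangian :: "('a::euclidean_space \<Rightarrow> real) \<Rightarrow> 'a \<Rightarrow> 'a \<Rightarrow> real" where
  "mech_lagrangian U q v = (1/2) * (v \<bullet> v) - U q"

definition Ld :: "('a::euclidean_space \<Rightarrow> real) \<Rightarrow> real \<Rightarrow> 'a \<Rightarrow> 'a \<Rightarrow> real" where
  "Ld U h x y = (h / 2) * mech_lagrangian U x ((1 / h) *\<^sub>R (y - x))
              + (h / 2) * mech_lagrangian U y ((1 / h) *\<^sub>R (y - x))"

definition cq :: "real \<Rightarrow> 'a::euclidean_space \<Rightarrow> 'a \<Rightarrow> 'a \<times> 'a" where
  "cq h x y = ((1 / h) *\<^sub>R (y - x), (1 / h) *\<^sub>R (y - x))"

lemma fvi_step_iff_legendre: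
  assumes "smooth U" and h: "h > 0"
  shows "fvi_step U \<rho> h (x, p) (x', p') \<longleftrightarrow>
     p  = - gradient (\<lambda>q. Ld U h q x') x + (\<rho> * h / 2) *\<^sub>R fst (cq h x x') \<and>
     p' = gradient (\<lambda>q. Ld U h x q) x' - (\<rho> * h / 2) *\<^sub>R snd (cq h x x')"
proof -
  have U: "(U has_derivative (\<lambda>v. v \<bullet> gradient U q)) (at q)" for q
    using smooth_GDERIV[OF \<open>smooth U\<close>] unfolding gderiv_def .
  have Ld: "Ld U h q r = (1 / (2 * h)) * ((r - q) \<bullet> (r - q)) - (h / 2) * U q - (h / 2) * U r" for q r
    using h unfolding Ld_def mech_lagrangian_def inner_scaleR_left inner_scaleR_right
    by (simp add: field_simps)
  have 1: "GDERIV (\<lambda>q. Ld U h q x') x :> - ((1 / h) *\<^sub>R (x' - x)) - (h / 2) *\<^sub>R gradient U x"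
    unfolding Ld gderiv_def
    apply (rule derivative_eq_intros U refl)+
    using h by (simp add: fun_eq_iff field_simps inner_simps inner_commute)
  have 2: "GDERIV (\<lambda>q. Ld U h x q) x' :> (1 / h) *\<^sub>R (x' - x) - (h / 2) *\<^sub>R gradient U x'"
    unfolding Ld gderiv_def
    apply (rule derivative_eq_intros U refl)+
    using h by (simp add: fun_eq_iff field_simps inner_simps inner_commute)
  show ?thesis
    unfolding gradient_eq[OF 1] gradient_eq[OF 2] using h
    by (simp add: fvi_step_def cq_def add.commute[of "(h / 2) *\<^sub>R gradient U x"])
qed

end

theory Submission
  imports Defs
begin

text \<open>
  For \<open>2\<alpha> = 1\<close> the system is the damped equation \<open>x' = p\<close>, \<open>p' = - g(x) - \<rho> p\<close>, where
  \<open>g\<close> is the gradient of \<open>U\<close>. Write \<open>(X, P)\<close> for the numerical step starting at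
  \<open>(x(t), p(t))\<close>, and \<open>a = p'\<close>.

  Position. The first equation of the scheme is solved for \<open>X\<close>:
  \<open>(1 + \<rho>h/2) (X - x(t)) = h p(t) - (h\<^sup>2/2) g(x(t))\<close>. Multiplying the Taylor polynomial
  \<open>h p + (h\<^sup>2/2) a\<close> of the exact increment by \<open>1 + \<rho>h/2\<close>, the friction term of \<open>a\<close> cancels
  and the same right-hand side appears, up to \<open>(\<rho>h\<^sup>3/4) a\<close>. So the error in \<open>X\<close> is the
  Taylor remainder plus a term \<open>O(h\<^sup>3)\<close> (\<open>fvi_position_error\<close>).

  Momentum. Eliminating \<open>(X - x(t))/h\<close> between the two equations gives
  \<open>P = p(t) - (h/2) (g(x(t)) + g(X)) - \<rho> (X - x(t))\<close>, while the exact solution satisfies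
  \<open>(p + \<rho> x)' = - g(x)\<close>. Hence \<open>P\<close> differs from \<open>p(t + h)\<close> by the error of
  the trapezoidal rule applied to \<open>g \<circ> x\<close>, which is \<open>O(h\<^sup>3)\<close>, and by terms controlled by the
  position error, through a Lipschitz bound for \<open>g\<close> (\<open>fvi_momentum_error\<close>).

  All constants are uniform in \<open>t\<close>: \<open>g \<circ> x\<close> is of class \<open>C\<^sup>2\<close> on the compact interval
  \<open>[0, T]\<close> (\<open>gradient_along_curve_C2\<close>), so it and its derivatives are bounded there, and
  \<open>X\<close> stays in a fixed ball, on which \<open>g\<close> is Lipschitz (\<open>gradient_lipschitz_on_cball\<close>).
\<close>

section \<open>Smooth functions and their gradients\<close>

lemma smooth_frechet_derivative:
  "smooth f \<Longrightarrow> smooth (\<lambda>x. frechet_derivative f (at x) v)"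
  unfolding smooth_def by (metis C_order.simps(2))

lemma smooth_has_derivative:
  "smooth f \<Longrightarrow> (f has_derivative frechet_derivative f (at x)) (at x)"
  unfolding smooth_def by (metis C_order.simps(2) frechet_derivative_works)

lemma smooth_continuous_on: "smooth f \<Longrightarrow> continuous_on S f"
  unfolding smooth_def by (metis C_order.simps(1) continuous_on_subset subset_UNIV)

lemma gradient_inner:
  assumes "smooth U"
  shows "gradient U z \<bullet> b = frechet_derivative U (at z) b"
proof -
  have "(\<lambda>h. h \<bullet> gradient U z) = frechet_derivative U (at z)"
    using smooth_GDERIV[OF assms] unfolding gderiv_def by (rule frechet_derivative_at)
  then show ?thesis by (metis inner_commute)
qed

lemma gradient_eq_sum:
  assumes "smooth U"
  shows "gradient U z = (\<Sum>b\<in>Basis. frechet_derivative U (at z) b *\<^sub>R b)"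
  by (metis (no_types, lifting) assms euclidean_representation gradient_inner sum.cong)

lemma linear_eq_sum_Basis:
  fixes F :: "'a::euclidean_space \<Rightarrow> real"
  assumes "linear F"
  shows "F v = (\<Sum>i\<in>Basis. (v \<bullet> i) * F i)"
proof -
  have "F v = F (\<Sum>i\<in>Basis. (v \<bullet> i) *\<^sub>R i)" by (simp add: euclidean_representation)
  also have "\<dots> = (\<Sum>i\<in>Basis. (v \<bullet> i) * F i)"
    by (simp add: linear_sum[OF assms] linear_scale[OF assms])
  finally show ?thesis .
qed

text \<open>The partial derivatives are continuous, hence bounded on the ball, which is convex;
  the mean value inequality gives the Lipschitz constant.\<close>

lemma smooth_lipschitz_on_cball:
  fixes f :: "'a::euclidean_space \<Rightarrow> real"
  assumes "smooth f"
  shows "\<exists>L\<ge>0. \<forall>y\<in>cball 0 R. \<forall>z\<in>cball 0 R. \<bar>f y - f z\<bar> \<le> L * norm (y - z)"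
proof -
  let ?D = "\<lambda>z. frechet_derivative f (at z)"
  have "\<exists>B. \<forall>z\<in>cball 0 R. \<bar>?D z i\<bar> \<le> B" for i
  proof -
    have "compact ((\<lambda>z. ?D z i) ` cball 0 R)"
      by (intro compact_continuous_image smooth_continuous_on smooth_frechet_derivative assms
          compact_cball)
    then show ?thesis
      using compact_imp_bounded bounded_real by (metis (no_types, lifting) image_eqI)
  qed
  then obtain B where B: "\<And>i z. z \<in> cball 0 R \<Longrightarrow> \<bar>?D z i\<bar> \<le> B i" by metis
  define L where "L = \<bar>\<Sum>i\<in>(Basis::'a set). B i\<bar>"
  have on: "onorm (?D z) \<le> L" if z: "z \<in> cball 0 R" for z
  proof (rule onorm_le)
    fix v
    have "\<bar>?D z v\<bar> = \<bar>\<Sum>i\<in>Basis. (v \<bullet> i) * ?D z i\<bar>"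
      using linear_eq_sum_Basis has_derivative_linear smooth_has_derivative[OF assms] by metis
    also have "\<dots> \<le> (\<Sum>i\<in>Basis. norm v * B i)"
      by (rule order_trans[OF sum_abs], rule sum_mono, unfold abs_mult)
        (rule mult_mono, auto simp: Basis_le_norm B[OF z])
    also have "\<dots> \<le> L * norm v"
      unfolding L_def sum_distrib_left[symmetric] by (simp add: mult.commute mult_left_mono)
    finally show "norm (?D z v) \<le> L * norm v" by simp
  qed
  have "norm (f y - f z) \<le> L * norm (y - z)" if "y \<in> cball 0 R" "z \<in> cball 0 R" for y z
    by (rule differentiable_bound[OF convex_cball _ on that])
      (auto intro: has_derivative_at_withinI smooth_has_derivative assms)
  moreover have "L \<ge> 0" by (simp add: L_def)
  ultimately show ?thesis by auto
qed

lemma gradient_lipschitz_on_cball: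
  fixes U :: "'a::euclidean_space \<Rightarrow> real"
  assumes "smooth U"
  shows "\<exists>L\<ge>0. \<forall>y\<in>cball 0 R. \<forall>z\<in>cball 0 R.
           norm (gradient U y - gradient U z) \<le> L * norm (y - z)"
proof -
  have "\<forall>b. \<exists>L\<ge>0. \<forall>y\<in>cball 0 R. \<forall>z\<in>cball 0 R.
      \<bar>gradient U y \<bullet> b - gradient U z \<bullet> b\<bar> \<le> L * norm (y - z)"
    unfolding gradient_inner[OF assms]
    by (intro allI smooth_lipschitz_on_cball smooth_frechet_derivative assms)
  then obtain L where L0: "\<And>b. L b \<ge> 0"
    and L: "\<And>b y z. y \<in> cball 0 R \<Longrightarrow> z \<in> cball 0 R \<Longrightarrow>
      \<bar>gradient U y \<bullet> b - gradient U z \<bullet> b\<bar> \<le> L b * norm (y - z)"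
    by metis
  have "norm (gradient U y - gradient U z) \<le> (\<Sum>b\<in>(Basis::'a set). L b) * norm (y - z)"
    if "y \<in> cball 0 R" "z \<in> cball 0 R" for y z
  proof -
    have "norm (gradient U y - gradient U z)
        \<le> (\<Sum>b\<in>Basis. \<bar>(gradient U y - gradient U z) \<bullet> b\<bar>)"
      by (rule norm_le_l1)
    also have "\<dots> \<le> (\<Sum>b\<in>Basis. L b * norm (y - z))"
      by (rule sum_mono) (use L[OF that] in \<open>simp add: inner_diff_left\<close>)
    finally show ?thesis by (simp add: sum_distrib_right)
  qed
  then show ?thesis using L0 by (meson sum_nonneg)
qed

section \<open>Smooth functions along a curve\<close>

lemma smooth_along_curve:
  assumes "smooth f" and x: "(x has_vector_derivative v) (at t within S)"
  shows "((\<lambda>s. f (x s)) has_vector_derivative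
           (\<Sum>i\<in>Basis. (v \<bullet> i) * frechet_derivative f (at (x t)) i)) (at t within S)"
proof -
  note f = smooth_has_derivative[OF \<open>smooth f\<close>, of "x t"]
  have "((f \<circ> x) has_vector_derivative frechet_derivative f (at (x t)) v) (at t within S)"
    by (rule vector_derivative_diff_chain_within[OF x has_derivative_at_withinI[OF f]])
  then show ?thesis
    using linear_eq_sum_Basis[OF has_derivative_linear[OF f], of v] by (simp add: o_def)
qed

text \<open>The first derivative is a sum of products of components of \<open>x'\<close> with smooth functions
  along \<open>x\<close>, so it can be differentiated by the same chain rule. The second derivative is
  continuous because \<open>x\<close>, \<open>x'\<close> and \<open>x''\<close> are.\<close>

lemma smooth_along_curve_C2:
  fixes x p a :: "real \<Rightarrow> 'a::euclidean_space"
  assumes f: "smooth f"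
    and x: "\<And>t. t \<in> S \<Longrightarrow> (x has_vector_derivative p t) (at t within S)"
    and p: "\<And>t. t \<in> S \<Longrightarrow> (p has_vector_derivative a t) (at t within S)"
    and a: "continuous_on S a"
  shows "\<exists>y1 y2. (\<forall>t\<in>S. ((\<lambda>s. f (x s)) has_vector_derivative y1 t) (at t within S)) \<and>
           (\<forall>t\<in>S. (y1 has_vector_derivative y2 t) (at t within S)) \<and> continuous_on S (y2 :: real \<Rightarrow> real)"
proof -
  let ?D = "\<lambda>i z. frechet_derivative f (at z) i"
  let ?DD = "\<lambda>i j z. frechet_derivative (?D i) (at z) j"
  define y1 where "y1 t = (\<Sum>i\<in>Basis. (p t \<bullet> i) * ?D i (x t))" for t
  define y2 where "y2 t = (\<Sum>i\<in>Basis. (p t \<bullet> i) * (\<Sum>j\<in>Basis. (p t \<bullet> j) * ?DD i j (x t))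
      + (a t \<bullet> i) * ?D i (x t))" for t
  have cx: "continuous_on S x" and cp: "continuous_on S p"
    using x p by (meson continuous_on_eq_continuous_within has_vector_derivative_continuous)+
  have c: "continuous_on S (\<lambda>t. g (x t))" if "smooth g" for g
    by (rule continuous_on_compose2[OF smooth_continuous_on[OF that, of UNIV] cx]) simp
  have "((\<lambda>s. f (x s)) has_vector_derivative y1 t) (at t within S)" if "t \<in> S" for t
    unfolding y1_def by (rule smooth_along_curve[OF f x[OF that]])
  moreover have "(y1 has_vector_derivative y2 t) (at t within S)" if t: "t \<in> S" for t
    unfolding y1_def y2_def
  proof (intro has_vector_derivative_sum has_vector_derivative_mult)
    fix i
    show "((\<lambda>s. p s \<bullet> i) has_vector_derivative a t \<bullet> i) (at t within S)"
      by (rule bounded_linear.has_vector_derivative[OF bounded_linear_inner_left p[OF t]])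
    show "((\<lambda>s. ?D i (x s)) has_vector_derivative (\<Sum>j\<in>Basis. (p t \<bullet> j) * ?DD i j (x t)))
        (at t within S)"
      by (rule smooth_along_curve[OF smooth_frechet_derivative[OF f] x[OF t]])
  qed
  moreover have "continuous_on S y2"
    unfolding y2_def
    by (intro continuous_intros c smooth_frechet_derivative f cp a)
  ultimately show ?thesis by blast
qed

lemma gradient_along_curve_C2:
  fixes x p a :: "real \<Rightarrow> 'a::euclidean_space"
  assumes U: "smooth U"
    and x: "\<And>t. t \<in> S \<Longrightarrow> (x has_vector_derivative p t) (at t within S)"
    and p: "\<And>t. t \<in> S \<Longrightarrow> (p has_vector_derivative a t) (at t within S)"
    and a: "continuous_on S a"
  obtains G1 G2 :: "real \<Rightarrow> 'a"
  where "\<And>t. t \<in> S \<Longrightarrow> ((\<lambda>s. gradient U (x s)) has_vector_derivative G1 t) (at t within S)"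
    and "\<And>t. t \<in> S \<Longrightarrow> (G1 has_vector_derivative G2 t) (at t within S)"
    and "continuous_on S G2"
proof -
  have "\<forall>b. \<exists>y1 y2.
      (\<forall>t\<in>S. ((\<lambda>s. frechet_derivative U (at (x s)) b) has_vector_derivative y1 t) (at t within S)) \<and>
      (\<forall>t\<in>S. (y1 has_vector_derivative y2 t) (at t within S)) \<and> continuous_on S (y2 :: real \<Rightarrow> real)"
    using smooth_along_curve_C2[OF smooth_frechet_derivative[OF U] x p a] by blast
  then obtain y1 y2 :: "'a \<Rightarrow> real \<Rightarrow> real"
    where y1: "\<And>b t. t \<in> S \<Longrightarrow>
        ((\<lambda>s. frechet_derivative U (at (x s)) b) has_vector_derivative y1 b t) (at t within S)"
      and y2: "\<And>b t. t \<in> S \<Longrightarrow> (y1 b has_vector_derivative y2 b t) (at t within S)"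
      and c: "\<And>b. continuous_on S (y2 b)"
    by metis
  note scale = bounded_linear.has_vector_derivative[OF bounded_linear_scaleR_left]
  show thesis
  proof (rule that)
    show "((\<lambda>s. gradient U (x s)) has_vector_derivative (\<Sum>b\<in>Basis. y1 b t *\<^sub>R b)) (at t within S)"
      if "t \<in> S" for t
      unfolding gradient_eq_sum[OF U] by (intro has_vector_derivative_sum scale y1 that)
    show "((\<lambda>t. \<Sum>b\<in>Basis. y1 b t *\<^sub>R b) has_vector_derivative (\<Sum>b\<in>Basis. y2 b t *\<^sub>R b))
        (at t within S)" if "t \<in> S" for t
      by (intro has_vector_derivative_sum scale y2 that)
    show "continuous_on S (\<lambda>t. \<Sum>b\<in>Basis. y2 b t *\<^sub>R b)"
      by (intro continuous_intros c)
  qed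
qed

section \<open>Taylor and trapezoidal remainders\<close>

lemma increment_bound:
  fixes f :: "real \<Rightarrow> 'a::real_normed_vector"
  assumes f: "\<And>s. s \<in> {t..u} \<Longrightarrow> (f has_vector_derivative f' s) (at s within {t..u})"
    and B: "\<And>s. s \<in> {t..u} \<Longrightarrow> norm (f' s) \<le> B" and s: "s \<in> {t..u}"
  shows "norm (f s - f t) \<le> B * (u - t)"
proof -
  have "onorm (\<lambda>h. h *\<^sub>R f' r) \<le> B" if "r \<in> {t..u}" for r
    by (rule onorm_le) (use mult_right_mono[OF B[OF that] abs_ge_zero] in \<open>simp add: mult.commute\<close>)
  then have "norm (f s - f t) \<le> B * norm (s - t)"
    using f s unfolding has_vector_derivative_def
    by (intro differentiable_bound[of "{t..u}" f "\<lambda>r h. h *\<^sub>R f' r"]) auto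
  also have "\<dots> \<le> B * (u - t)"
    using s order_trans[OF norm_ge_zero B[OF s]] by (intro mult_left_mono) auto
  finally show ?thesis .
qed

text \<open>In both remainder estimates the remainder and its derivatives vanish at \<open>t\<close>, so
  applying the mean value inequality once per order turns the bound on the highest derivative
  into \<open>O((u - t)\<^sup>3)\<close>. Each application bounds the derivative by its maximum over the whole
  interval, so the constants are not sharp.\<close>

lemma taylor2_remainder:
  fixes x p a j :: "real \<Rightarrow> 'a::real_normed_vector"
  assumes x: "\<And>s. s \<in> {t..u} \<Longrightarrow> (x has_vector_derivative p s) (at s within {t..u})"
    and p: "\<And>s. s \<in> {t..u} \<Longrightarrow> (p has_vector_derivative a s) (at s within {t..u})"
    and a: "\<And>s. s \<in> {t..u} \<Longrightarrow> (a has_vector_derivative j s) (at s within {t..u})"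
    and M: "\<And>s. s \<in> {t..u} \<Longrightarrow> norm (j s) \<le> M" and "t \<le> u"
  shows "norm (x u - x t - (u - t) *\<^sub>R p t - ((u - t)\<^sup>2 / 2) *\<^sub>R a t) \<le> M * (u - t) ^ 3"
proof -
  define r1 where "r1 s = p s - p t - (s - t) *\<^sub>R a t" for s
  define r0 where "r0 s = x s - x t - (s - t) *\<^sub>R p t - ((s - t)\<^sup>2 / 2) *\<^sub>R a t" for s
  have d1: "(r1 has_vector_derivative a s - a t) (at s within {t..u})" if "s \<in> {t..u}" for s
    unfolding r1_def by (rule derivative_eq_intros p that refl | simp)+
  have d0: "(r0 has_vector_derivative r1 s) (at s within {t..u})" if "s \<in> {t..u}" for s
    unfolding r0_def r1_def
    by (rule derivative_eq_intros x that refl | simp)+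
  have b1: "norm (r1 s - r1 t) \<le> M * (u - t) * (u - t)" if "s \<in> {t..u}" for s
    using increment_bound[OF a M] increment_bound[OF d1 _ that] by blast
  have "norm (r0 u - r0 t) \<le> M * (u - t) * (u - t) * (u - t)"
    by (rule increment_bound[OF d0]) (use b1 \<open>t \<le> u\<close> in \<open>auto simp: r1_def\<close>)
  then show ?thesis by (simp add: r0_def power3_eq_cube mult.assoc)
qed

lemma trapezoidal_remainder:
  fixes q w w1 w2 :: "real \<Rightarrow> 'a::real_normed_vector"
  assumes q: "\<And>s. s \<in> {t..u} \<Longrightarrow> (q has_vector_derivative w s) (at s within {t..u})"
    and w: "\<And>s. s \<in> {t..u} \<Longrightarrow> (w has_vector_derivative w1 s) (at s within {t..u})"
    and w1: "\<And>s. s \<in> {t..u} \<Longrightarrow> (w1 has_vector_derivative w2 s) (at s within {t..u})"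
    and M: "\<And>s. s \<in> {t..u} \<Longrightarrow> norm (w2 s) \<le> M" and "t \<le> u"
  shows "norm (q u - q t - ((u - t) / 2) *\<^sub>R (w u + w t)) \<le> M * (u - t) ^ 3"
proof -
  define e where "e s = q s - q t - ((s - t) / 2) *\<^sub>R (w s + w t)" for s
  define e1 where "e1 s = (1/2) *\<^sub>R (w s - w t) - ((s - t) / 2) *\<^sub>R w1 s" for s
  have d: "(e has_vector_derivative e1 s) (at s within {t..u})" if "s \<in> {t..u}" for s
  proof -
    have "(e has_vector_derivative w s - (((s - t) / 2) *\<^sub>R w1 s + (1/2) *\<^sub>R (w s + w t)))
        (at s within {t..u})"
      unfolding e_def by (rule derivative_eq_intros q w that refl | simp)+
    moreover have "w s - (((s - t) / 2) *\<^sub>R w1 s + (1/2) *\<^sub>R (w s + w t)) = e1 s"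
    proof -
      have "w s - (((s - t) / 2) *\<^sub>R w1 s + (1/2) *\<^sub>R (w s + w t))
          = (w s - (1/2) *\<^sub>R w s) - (1/2) *\<^sub>R w t - ((s - t) / 2) *\<^sub>R w1 s"
        by (simp add: algebra_simps)
      also have "w s - (1/2) *\<^sub>R w s = (1/2) *\<^sub>R w s"
        using scaleR_left_diff_distrib[of 1 "1/2" "w s"] by simp
      finally show ?thesis by (simp add: e1_def algebra_simps)
    qed
    ultimately show ?thesis by simp
  qed
  \<comment> \<open>In the derivative of \<open>e1\<close> the two terms \<open>w1 s / 2\<close> cancel.\<close>
  have d1: "(e1 has_vector_derivative - ((s - t) / 2) *\<^sub>R w2 s) (at s within {t..u})"
    if "s \<in> {t..u}" for s
    unfolding e1_def by (rule derivative_eq_intros w w1 that refl | simp)+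
  have b2: "norm (- ((s - t) / 2) *\<^sub>R w2 s) \<le> M * (u - t)" if s: "s \<in> {t..u}" for s
  proof -
    have "norm (- ((s - t) / 2) *\<^sub>R w2 s) = ((s - t) / 2) * norm (w2 s)" using s by simp
    also have "\<dots> \<le> (u - t) * M" using s by (intro mult_mono M) auto
    finally show ?thesis by (simp add: mult.commute)
  qed
  have b1: "norm (e1 s) \<le> M * (u - t) * (u - t)" if "s \<in> {t..u}" for s
    using increment_bound[OF d1 b2 that] by (simp add: e1_def)
  have "norm (e u - e t) \<le> M * (u - t) * (u - t) * (u - t)"
    by (rule increment_bound[OF d b1]) (use \<open>t \<le> u\<close> in auto)
  then show ?thesis by (simp add: e_def power3_eq_cube mult.assoc)
qed

section \<open>Local error of the scheme\<close>

text \<open>Here \<open>y\<close> is the exact position after time \<open>h\<close>, and \<open>r\<close> bounds its Taylor remainder.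
  The factor \<open>1 + \<rho>h/2\<close> in front of the position error is at least \<open>1\<close> and can be dropped.\<close>

lemma fvi_position_error:
  assumes h: "h > 0" and \<rho>: "\<rho> > 0"
    and step: "fvi_step U \<rho> h (x, p) (X, P)"
    and a: "a = - gradient U x - \<rho> *\<^sub>R p"
    and r: "norm (y - x - h *\<^sub>R p - (h\<^sup>2 / 2) *\<^sub>R a) \<le> M * h ^ 3"
    and A: "norm a \<le> A"
  shows "norm (X - y) \<le> (\<rho> / 4 * A + M) * h ^ 3"
proof -
  define c where "c = 1 + \<rho> * h / 2"
  have c: "c \<ge> 1" using h \<rho> by (simp add: c_def)
  define R where "R = y - x - h *\<^sub>R p - (h\<^sup>2 / 2) *\<^sub>R a"
  have "p = (1 / h) *\<^sub>R (X - x) + (h / 2) *\<^sub>R gradient U x + (\<rho> / 2) *\<^sub>R (X - x)"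
    using step by (simp add: fvi_step_def)
  then have "h *\<^sub>R p
      = h *\<^sub>R ((1 / h) *\<^sub>R (X - x) + (h / 2) *\<^sub>R gradient U x + (\<rho> / 2) *\<^sub>R (X - x))"
    by simp
  also have "\<dots> = c *\<^sub>R (X - x) + (h\<^sup>2 / 2) *\<^sub>R gradient U x"
    using h by (simp add: c_def scaleR_right_distrib scaleR_left_distrib power2_eq_square mult.commute)
  finally have X: "c *\<^sub>R (X - x) = h *\<^sub>R p - (h\<^sup>2 / 2) *\<^sub>R gradient U x" by simp
  have g: "gradient U x = - a - \<rho> *\<^sub>R p" by (simp add: a)
  have "c *\<^sub>R (X - y) = c *\<^sub>R (X - x) - c *\<^sub>R (R + h *\<^sub>R p + (h\<^sup>2 / 2) *\<^sub>R a)"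
    by (simp add: R_def algebra_simps)
  also have "\<dots> = h *\<^sub>R p - (h\<^sup>2 / 2) *\<^sub>R (- a - \<rho> *\<^sub>R p) - c *\<^sub>R (R + h *\<^sub>R p + (h\<^sup>2 / 2) *\<^sub>R a)"
    unfolding X g ..
  also have "\<dots> = - ((\<rho> / 4 * h ^ 3) *\<^sub>R a) - c *\<^sub>R R"
    by (simp add: c_def algebra_simps power2_eq_square power3_eq_cube)
  finally have "norm (c *\<^sub>R (X - y)) = norm ((\<rho> / 4 * h ^ 3) *\<^sub>R a + c *\<^sub>R R)"
    by (metis minus_add_distrib norm_minus_cancel uminus_add_conv_diff add.commute)
  also have "\<dots> \<le> \<rho> / 4 * h ^ 3 * norm a + c * norm R"
    by (rule norm_triangle_le) (use c h \<rho> in simp)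
  also have "\<dots> \<le> \<rho> / 4 * h ^ 3 * A + c * (M * h ^ 3)"
    using A r c h \<rho> unfolding R_def by (intro add_mono mult_left_mono) auto
  also have "\<dots> \<le> c * (\<rho> / 4 * h ^ 3 * A) + c * (M * h ^ 3)"
  proof -
    have "0 \<le> \<rho> / 4 * h ^ 3 * A"
      using order_trans[OF norm_ge_zero A] h \<rho> by simp
    then show ?thesis using mult_right_mono[OF c] by simp
  qed
  also have "\<dots> = c * ((\<rho> / 4 * A + M) * h ^ 3)" by (simp add: algebra_simps)
  finally show ?thesis using c by simp
qed

text \<open>Here \<open>(y, q)\<close> is the exact position and momentum after time \<open>h\<close>, and \<open>r\<close> bounds the
  trapezoidal remainder of \<open>p + \<rho> x\<close>. The Lipschitz term carries an extra factor \<open>h/2\<close>,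
  which \<open>T/2\<close> bounds.\<close>

lemma fvi_momentum_error:
  assumes h: "h > 0" and \<rho>: "\<rho> > 0"
    and step: "fvi_step U \<rho> h (x, p) (X, P)"
    and r: "norm ((q + \<rho> *\<^sub>R y) - (p + \<rho> *\<^sub>R x)
              - (h / 2) *\<^sub>R (- gradient U y - gradient U x)) \<le> M * h ^ 3"
    and g: "norm (gradient U X - gradient U y) \<le> L * norm (X - y)"
    and y: "norm (X - y) \<le> K * h ^ 3"
    and "L \<ge> 0" and "h \<le> T"
  shows "norm (P - q) \<le> (M + T / 2 * L * K + \<rho> * K) * h ^ 3"
proof -
  define R where "R = (q + \<rho> *\<^sub>R y) - (p + \<rho> *\<^sub>R x) - (h / 2) *\<^sub>R (- gradient U y - gradient U x)"
  have "P - p = - (h / 2) *\<^sub>R (gradient U x + gradient U X) - \<rho> *\<^sub>R (X - x)"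
  proof -
    have "\<rho> *\<^sub>R (X - x) = (\<rho> / 2) *\<^sub>R (X - x) + (\<rho> / 2) *\<^sub>R (X - x)"
      by (simp flip: scaleR_left_distrib)
    moreover have p: "p = (1 / h) *\<^sub>R (X - x) + (h / 2) *\<^sub>R gradient U x + (\<rho> / 2) *\<^sub>R (X - x)"
      and P: "P = (1 / h) *\<^sub>R (X - x) - (h / 2) *\<^sub>R gradient U X - (\<rho> / 2) *\<^sub>R (X - x)"
      using step by (simp_all add: fvi_step_def)
    have "P - p = - (h / 2) *\<^sub>R (gradient U x + gradient U X)
        - ((\<rho> / 2) *\<^sub>R (X - x) + (\<rho> / 2) *\<^sub>R (X - x))"
      by (subst p, subst P) (simp add: scaleR_right_distrib del: scaleR_half_double)
    ultimately show ?thesis by simp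
  qed
  then have "P - q = - (R + (h / 2) *\<^sub>R (gradient U X - gradient U y) + \<rho> *\<^sub>R (X - y))"
    by (simp add: R_def algebra_simps)
  then have "norm (P - q) \<le> norm R + h / 2 * norm (gradient U X - gradient U y) + \<rho> * norm (X - y)"
    using h \<rho> by (simp only: norm_minus_cancel) (intro norm_triangle_le add_mono; simp)
  also have "\<dots> \<le> M * h ^ 3 + T / 2 * (L * (K * h ^ 3)) + \<rho> * (K * h ^ 3)"
  proof (intro add_mono)
    have "norm (gradient U X - gradient U y) \<le> L * (K * h ^ 3)"
      using g mult_left_mono[OF y \<open>L \<ge> 0\<close>] by linarith
    then show "h / 2 * norm (gradient U X - gradient U y) \<le> T / 2 * (L * (K * h ^ 3))"
      using h \<open>h \<le> T\<close> by (intro mult_mono) auto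
  qed (use r y \<rho> in \<open>auto simp: R_def\<close>)
  finally show ?thesis by (simp add: algebra_simps)
qed

lemma continuous_on_interval_bound:
  fixes f :: "real \<Rightarrow> 'a::real_normed_vector"
  assumes "continuous_on {a..b} f"
  obtains B where "\<And>t. t \<in> {a..b} \<Longrightarrow> norm (f t) \<le> B"
proof -
  have "bounded (f ` {a..b})"
    by (intro compact_imp_bounded compact_continuous_image assms compact_Icc)
  then show thesis using that unfolding bounded_iff by blast
qed

theorem theorem4p3:
  fixes U :: "real ^ 'd \<Rightarrow> real"
    and \<rho> \<alpha> T :: real
    and x p :: "real \<Rightarrow> real ^ 'd"
  assumes "smooth U" and "\<rho> > 0" and "\<alpha> = 1/2" and "T > 0"
    and "frac_damped_solution U \<rho> \<alpha> T x p"
  shows "(\<exists>C. \<forall>\<^sub>F h in at_right 0. \<forall>t\<in>{0..<T}. t + h \<le> T \<longrightarrow>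
            norm (fst (fvi_map U \<rho> h (x t, p t)) - x (t + h)) \<le> C * h ^ 3) \<and>
         (\<exists>C. \<forall>\<^sub>F h in at_right 0. \<forall>t\<in>{0..<T}. t + h \<le> T \<longrightarrow>
            norm (snd (fvi_map U \<rho> h (x t, p t)) - p (t + h)) \<le> C * h ^ 3)"
proof -
  let ?I = "{0..T}"
  define a where "a t = - gradient U (x t) - \<rho> *\<^sub>R p t" for t
  have x: "\<And>t. t \<in> ?I \<Longrightarrow> (x has_vector_derivative p t) (at t within ?I)"
    and p: "\<And>t. t \<in> ?I \<Longrightarrow> (p has_vector_derivative a t) (at t within ?I)"
    using assms frac_damped_solution_half[OF \<open>T > 0\<close>] unfolding a_def by blast+
  have cont: "continuous_on ?I f"
    if "\<And>t. t \<in> ?I \<Longrightarrow> (f has_vector_derivative f' t) (at t within ?I)"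
    for f f' :: "real \<Rightarrow> real ^ 'd"
    using that by (meson continuous_on_eq_continuous_within has_vector_derivative_continuous)
  have cg: "continuous_on ?I (\<lambda>t. gradient U (x t))"
    unfolding gradient_eq_sum[OF \<open>smooth U\<close>]
    by (intro continuous_intros
        continuous_on_compose2[OF smooth_continuous_on[of _ UNIV] cont[OF x]]
        smooth_frechet_derivative \<open>smooth U\<close>) auto
  have ca: "continuous_on ?I a"
    unfolding a_def by (intro continuous_intros cg cont[OF p])
  obtain G1 G2 :: "real \<Rightarrow> real ^ 'd"
    where G: "\<And>t. t \<in> ?I \<Longrightarrow> ((\<lambda>s. gradient U (x s)) has_vector_derivative G1 t) (at t within ?I)"
      and G1: "\<And>t. t \<in> ?I \<Longrightarrow> (G1 has_vector_derivative G2 t) (at t within ?I)"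
      and cG2: "continuous_on ?I G2"
    using gradient_along_curve_C2[OF \<open>smooth U\<close> x p ca] by blast
  define j where "j t = - G1 t - \<rho> *\<^sub>R a t" for t
  have a: "(a has_vector_derivative j t) (at t within ?I)" if "t \<in> ?I" for t
    unfolding a_def[abs_def] j_def
    by (rule derivative_eq_intros G p that refl | simp add: a_def)+
  have cj: "continuous_on ?I j"
    unfolding j_def by (intro continuous_intros ca cont[OF G1])
  obtain A where A: "\<And>t. t \<in> ?I \<Longrightarrow> norm (a t) \<le> A"
    using continuous_on_interval_bound[OF ca] by blast
  obtain J where J: "\<And>t. t \<in> ?I \<Longrightarrow> norm (j t) \<le> J"
    using continuous_on_interval_bound[OF cj] by blast
  obtain M where M: "\<And>t. t \<in> ?I \<Longrightarrow> norm (G2 t) \<le> M"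
    using continuous_on_interval_bound[OF cG2] by blast
  obtain B where B: "\<And>t. t \<in> ?I \<Longrightarrow> norm (x t) \<le> B"
    using continuous_on_interval_bound[OF cont[OF x]] by blast
  define K where "K = \<rho> / 4 * A + J"
  have "0 \<in> ?I" using \<open>T > 0\<close> by simp
  have K: "K \<ge> 0"
    using order_trans[OF norm_ge_zero A[OF \<open>0 \<in> ?I\<close>]] order_trans[OF norm_ge_zero J[OF \<open>0 \<in> ?I\<close>]]
      \<open>\<rho> > 0\<close> by (simp add: K_def)
  \<comment> \<open>A ball that contains the exact positions and, since \<open>h \<le> T\<close>, the numerical ones.\<close>
  obtain L where L0: "L \<ge> 0" and L: "\<And>y z. y \<in> cball 0 (B + K * T ^ 3) \<Longrightarrow>
      z \<in> cball 0 (B + K * T ^ 3) \<Longrightarrow> norm (gradient U y - gradient U z) \<le> L * norm (y - z)"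
    using gradient_lipschitz_on_cball[OF \<open>smooth U\<close>] by metis

  have errors: "norm (fst (fvi_map U \<rho> h (x t, p t)) - x (t + h)) \<le> K * h ^ 3 \<and>
      norm (snd (fvi_map U \<rho> h (x t, p t)) - p (t + h)) \<le> (M + T / 2 * L * K + \<rho> * K) * h ^ 3"
    if h: "h > 0" and t: "t \<in> {0..<T}" and th: "t + h \<le> T" for h t
  proof -
    obtain X P where XP: "fvi_map U \<rho> h (x t, p t) = (X, P)" by fastforce
    have step: "fvi_step U \<rho> h (x t, p t) (X, P)"
      using fvi_step_fvi_map[OF h \<open>\<rho> > 0\<close>] XP by metis
    have sub: "{t..t+h} \<subseteq> ?I" using t th by auto
    have restrict: "(f has_vector_derivative f' s) (at s within {t..t+h})"
      if "\<And>s. s \<in> ?I \<Longrightarrow> (f has_vector_derivative f' s) (at s within ?I)" "s \<in> {t..t+h}"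
      for f f' :: "real \<Rightarrow> real ^ 'd" and s
      using that sub by (meson has_vector_derivative_within_subset subsetD)
    have t': "t \<in> ?I" and th': "t + h \<in> ?I" and hT: "h \<le> T" using t th h by auto
    have "norm (x (t + h) - x t - (t + h - t) *\<^sub>R p t - ((t + h - t)\<^sup>2 / 2) *\<^sub>R a t)
        \<le> J * (t + h - t) ^ 3"
      by (rule taylor2_remainder[OF restrict[OF x] restrict[OF p] restrict[OF a]])
        (use J sub h in auto)
    then have posn: "norm (X - x (t + h)) \<le> K * h ^ 3"
      unfolding K_def
      by (intro fvi_position_error[OF h \<open>\<rho> > 0\<close> step a_def _ A[OF t']]) simp
    have "K * h ^ 3 \<le> K * T ^ 3"
      using K hT h by (intro mult_left_mono power_mono) auto
    moreover have "norm X \<le> norm (x (t + h)) + norm (X - x (t + h))"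
      by (rule norm_triangle_sub)
    ultimately have "X \<in> cball 0 (B + K * T ^ 3)"
      using posn B[OF th'] by simp
    moreover have "x (t + h) \<in> cball 0 (B + K * T ^ 3)"
      using B[OF th'] K \<open>T > 0\<close> by (simp add: add_increasing2)
    ultimately have g: "norm (gradient U X - gradient U (x (t + h))) \<le> L * norm (X - x (t + h))"
      by (rule L)
    define q where "q s = p s + \<rho> *\<^sub>R x s" for s
    \<comment> \<open>The friction cancels: \<open>q\<close> is driven by the potential force alone.\<close>
    have q: "(q has_vector_derivative - gradient U (x s)) (at s within ?I)" if "s \<in> ?I" for s
      unfolding q_def by (rule derivative_eq_intros x p that refl | simp add: a_def)+
    have w: "((\<lambda>s. - gradient U (x s)) has_vector_derivative - G1 s) (at s within ?I)"
      and w1: "((\<lambda>s. - G1 s) has_vector_derivative - G2 s) (at s within ?I)" if "s \<in> ?I" for s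
      using G[OF that] G1[OF that] by (auto intro: has_vector_derivative_minus)
    have "norm (q (t + h) - q t
        - ((t + h - t) / 2) *\<^sub>R (- gradient U (x (t + h)) + - gradient U (x t))) \<le> M * (t + h - t) ^ 3"
      by (rule trapezoidal_remainder[OF restrict[OF q] restrict[OF w] restrict[OF w1]])
        (use M sub h in auto)
    then have "norm (P - p (t + h)) \<le> (M + T / 2 * L * K + \<rho> * K) * h ^ 3"
      by (intro fvi_momentum_error[OF h \<open>\<rho> > 0\<close> step _ g posn L0 hT]) (simp add: q_def)
    with posn show ?thesis by (simp add: XP)
  qed
  have "\<forall>\<^sub>F h in at_right (0::real). h > 0" by (rule eventually_at_right_less)
  then have "\<forall>\<^sub>F h in at_right 0. \<forall>t\<in>{0..<T}. t + h \<le> T \<longrightarrow>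
      norm (fst (fvi_map U \<rho> h (x t, p t)) - x (t + h)) \<le> K * h ^ 3"
    and "\<forall>\<^sub>F h in at_right 0. \<forall>t\<in>{0..<T}. t + h \<le> T \<longrightarrow>
      norm (snd (fvi_map U \<rho> h (x t, p t)) - p (t + h)) \<le> (M + T / 2 * L * K + \<rho> * K) * h ^ 3"
    using errors by (auto elim!: eventually_mono)
  then show ?thesis by blast
qed

end
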